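(* Let $X$ be a pointed metric space, $E$ a Banach space and $\alpha$ a dualizable Lipschitz cross-norm on $X\boxtimes E$. For every $g\in X^\#$ and $\phi\in E^*$, the map $g\cdot\phi$ belongs to $\mathrm{Lip}_\alpha(X,E^* )$ and $\mathrm{Lip}_\alpha(g\cdot\phi)=\mathrm{Lip}(g)\|\phi\|$. As a consequence, $\mathrm{Lip}_{0F}(X,E^* )$ is contained in $\mathrm{Lip}_\alpha(X,E^* )$.
   Context: $\mathbb{K}$ is $\mathbb R$ or $\mathbb C$. A pointed metric space $X$ is a metric space with metric $d$ and a designated base point $0$; a normed space is pointed by its zero vector. For a Banach space $F$, $\mathrm{Lip}_0(X,F)$ is the space of base-point preserving Lipschitz maps $X\to F$, with norm $\mathrm{Lip}$ (least Lipschitz constant); $X^\#=\mathrm{Lip}_0(X,\mathbb K)$; $E^*$ is the topological dual. The Lipschitz tensor product $X\boxtimes E$ is the linear span of all linear functionals $\delta_{(x,y)}\boxtimes e$ on $\mathrm{Lip}_0(X,E^* )$ of the form $(\delta_{(x,y)}\boxtimes e)(f)=\langle f(x)-f(y),e\rangle$, for $x,y\in X$ and $e\in E$. A norm $\alpha$ on $X\boxtimes E$ is a Lipschitz cross-norm if $\alpha(\delta_{(x,y)}\boxtimes e)=d(x,y)\|e\|$ for all $x,y\in X$, $e\in E$. It is dualizable if $\left|\sum_{i=1}^n(g(x_i)-g(y_i))\langle\phi,e_i\rangle\right|\le\mathrm{Lip}(g)\|\phi\|\,\alpha\left(\sum_{i=1}^n\delta_{(x_i,y_i)}\boxtimes e_i\right)$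 for all $g\in X^\#$, $\phi\in E^*$ and $\sum_{i=1}^n\delta_{(x_i,y_i)}\boxtimes e_i\in X\boxtimes E$. A base-point preserving map $f\colon X\to E^*$ is an $\alpha$-Lipschitz operator if there is $C\ge 0$ with $\left|\sum_{i=1}^n\langle f(x_i)-f(y_i),e_i\rangle\right|\le C\,\alpha\left(\sum_{i=1}^n\delta_{(x_i,y_i)}\boxtimes e_i\right)$ for all $\sum_{i=1}^n\delta_{(x_i,y_i)}\boxtimes e_i\in X\boxtimes E$; the infimum of such $C$ is $\mathrm{Lip}_\alpha(f)$, and $\mathrm{Lip}_\alpha(X,E^* )$ is the set of all such maps. For $g\in X^\#$ and $\phi\in E^*$, $g\cdot\phi\colon X\to E^*$ is the map $(g\cdot\phi)(x)=g(x)\phi$. $\mathrm{Lip}_{0F}(X,E^* )$ is the space of Lipschitz finite-rank operators, i.e. those $f\in\mathrm{Lip}_0(X,E^* )$ for which the linear span of $f(X)$ is finite dimensional. *)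

theory Defs
  imports "HOL-Analysis.Analysis" "HOL-Library.Function_Algebras"
begin

text \<open>The scalar field \<open>\<K>\<close> is \<open>\<real>\<close> or \<open>\<complex>\<close>: a type in this class is a normed field which is
  isometrically isomorphic to one of these two.\<close>

class real_or_complex = real_normed_field +
  assumes real_or_complex:
    "(\<exists>j :: 'a \<Rightarrow> real. bij j \<and> (\<forall>a b. j (a + b) = j a + j b) \<and> (\<forall>a b. j (a * b) = j a * j b)
        \<and> (\<forall>r a. j (scaleR r a) = scaleR r (j a)) \<and> (\<forall>a. norm (j a) = norm a)) \<or>
     (\<exists>j :: 'a \<Rightarrow> complex. bij j \<and> (\<forall>a b. j (a + b) = j a + j b) \<and> (\<forall>a b. j (a * b) = j a * j b)
        \<and> (\<forall>r a. j (scaleR r a) = scaleR r (j a)) \<and> (\<forall>a. norm (j a) = norm a))"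

instance real :: real_or_complex
  by standard (rule disjI1, rule exI[of _ id], simp)

instance complex :: real_or_complex
  by standard (rule disjI2, rule exI[of _ id], simp)

text \<open>A Banach space over \<open>\<K>\<close>: the type class \<open>banach\<close> only provides the real structure, so the
  scalar multiplication by \<open>\<K>\<close> is an explicit parameter \<open>sc\<close> extending it.\<close>

definition banach_over :: "('k::real_or_complex \<Rightarrow> 'e::banach \<Rightarrow> 'e) \<Rightarrow> bool" where
  "banach_over sc \<longleftrightarrow> vector_space sc
     \<and> (\<forall>r v. sc (of_real r) v = scaleR r v)
     \<and> (\<forall>c v. norm (sc c v) = norm c * norm v)"

text \<open>\<open>E\<^sup>*\<close>: the \<open>\<K>\<close>-linear elements of the type of bounded real-linear maps \<open>E \<rightarrow> \<K>\<close>, with the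
  operator norm of that type.\<close>

definition dual :: "('k::real_or_complex \<Rightarrow> 'e::banach \<Rightarrow> 'e) \<Rightarrow> ('e \<Rightarrow>\<^sub>L 'k) set" where
  "dual sc = {\<phi>. \<forall>c v. blinfun_apply \<phi> (sc c v) = c * blinfun_apply \<phi> v}"

definition dual_scale :: "'k::real_or_complex \<Rightarrow> ('e::banach \<Rightarrow>\<^sub>L 'k) \<Rightarrow> ('e \<Rightarrow>\<^sub>L 'k)" where
  "dual_scale c \<phi> = Blinfun (\<lambda>v. c * blinfun_apply \<phi> v)"

lemma blinfun_apply_dual_scale [simp]:
  "blinfun_apply (dual_scale c \<phi>) v = c * blinfun_apply \<phi> v"
  unfolding dual_scale_def
  by (subst bounded_linear_Blinfun_apply) (auto intro!: bounded_linear_intros)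

lemma vector_space_dual_scale: "vector_space (dual_scale :: 'k::real_or_complex \<Rightarrow> ('e::banach \<Rightarrow>\<^sub>L 'k) \<Rightarrow> _)"
  by unfold_locales (auto intro!: blinfun_eqI simp: algebra_simps blinfun.add_left)

text \<open>\<open>F\<close> is the carrier of the target space inside its ambient type.\<close>

definition Lip0 :: "'x::metric_space \<Rightarrow> 'f::real_normed_vector set \<Rightarrow> ('x \<Rightarrow> 'f) set" where
  "Lip0 x0 F = {f. range f \<subseteq> F \<and> f x0 = 0 \<and> (\<exists>C. C-lipschitz_on UNIV f)}"

definition Lip :: "('x::metric_space \<Rightarrow> 'f::real_normed_vector) \<Rightarrow> real" where
  "Lip f = Inf {C. C-lipschitz_on UNIV f}"

abbreviation lip_dual :: "'x::metric_space \<Rightarrow> ('x \<Rightarrow> 'k::real_or_complex) set" where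
  "lip_dual x0 \<equiv> Lip0 x0 UNIV"

text \<open>A functional on \<open>Lip\<^sub>0(X, E\<^sup>*)\<close> is a function on the whole type \<open>'x \<Rightarrow> 'e \<Rightarrow>\<^sub>L 'k\<close> that is set to
  \<open>0\<close> outside \<open>Lip\<^sub>0(X, E\<^sup>*)\<close>, so that equality of such functions is equality of functionals.\<close>

type_synonym ('x, 'e, 'k) functional = "('x \<Rightarrow> 'e \<Rightarrow>\<^sub>L 'k) \<Rightarrow> 'k"

definition delta_tensor ::
  "'x::metric_space \<Rightarrow> ('k::real_or_complex \<Rightarrow> 'e::banach \<Rightarrow> 'e) \<Rightarrow> 'x \<Rightarrow> 'x \<Rightarrow> 'e \<Rightarrow> ('x, 'e, 'k) functional" where
  "delta_tensor x0 sc x y e =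
     (\<lambda>f. if f \<in> Lip0 x0 (dual sc) then blinfun_apply (f x - f y) e else 0)"

definition functional_scale ::
  "'k::real_or_complex \<Rightarrow> ('x, 'e::banach, 'k) functional \<Rightarrow> ('x, 'e, 'k) functional" where
  "functional_scale c u = (\<lambda>f. c * u f)"

lemma vector_space_functional_scale:
  "vector_space (functional_scale :: 'k::real_or_complex \<Rightarrow> ('x, 'e::banach, 'k) functional \<Rightarrow> _)"
  by unfold_locales (auto simp: functional_scale_def fun_eq_iff algebra_simps)

definition lip_tensor ::
  "'x::metric_space \<Rightarrow> ('k::real_or_complex \<Rightarrow> 'e::banach \<Rightarrow> 'e) \<Rightarrow> ('x, 'e, 'k) functional set" where
  "lip_tensor x0 sc = module.span functional_scale {delta_tensor x0 sc x y e | x y e. True}"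

definition norm_on ::
  "('k::real_or_complex \<Rightarrow> 'v::ab_group_add \<Rightarrow> 'v) \<Rightarrow> 'v set \<Rightarrow> ('v \<Rightarrow> real) \<Rightarrow> bool" where
  "norm_on scl V \<alpha> \<longleftrightarrow>
     (\<forall>u\<in>V. 0 \<le> \<alpha> u) \<and> (\<forall>u\<in>V. \<alpha> u = 0 \<longleftrightarrow> u = 0)
     \<and> (\<forall>u\<in>V. \<forall>v\<in>V. \<alpha> (u + v) \<le> \<alpha> u + \<alpha> v)
     \<and> (\<forall>c. \<forall>u\<in>V. \<alpha> (scl c u) = norm c * \<alpha> u)"

definition lipschitz_cross_norm ::
  "'x::metric_space \<Rightarrow> ('k::real_or_complex \<Rightarrow> 'e::banach \<Rightarrow> 'e) \<Rightarrow> (('x, 'e, 'k) functional \<Rightarrow> real) \<Rightarrow> bool" where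
  "lipschitz_cross_norm x0 sc \<alpha> \<longleftrightarrow>
     norm_on functional_scale (lip_tensor x0 sc) \<alpha>
     \<and> (\<forall>x y e. \<alpha> (delta_tensor x0 sc x y e) = dist x y * norm e)"

definition dualizable ::
  "'x::metric_space \<Rightarrow> ('k::real_or_complex \<Rightarrow> 'e::banach \<Rightarrow> 'e) \<Rightarrow> (('x, 'e, 'k) functional \<Rightarrow> real) \<Rightarrow> bool" where
  "dualizable x0 sc \<alpha> \<longleftrightarrow>
     (\<forall>g \<in> lip_dual x0. \<forall>\<phi> \<in> dual sc. \<forall>(n::nat) x y e.
        norm (\<Sum>i<n. (g (x i) - g (y i)) * blinfun_apply \<phi> (e i))
          \<le> Lip g * norm \<phi> * \<alpha> (\<Sum>i<n. delta_tensor x0 sc (x i) (y i) (e i)))"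

definition alpha_bound ::
  "'x::metric_space \<Rightarrow> ('k::real_or_complex \<Rightarrow> 'e::banach \<Rightarrow> 'e) \<Rightarrow> (('x, 'e, 'k) functional \<Rightarrow> real)
     \<Rightarrow> ('x \<Rightarrow> 'e \<Rightarrow>\<^sub>L 'k) \<Rightarrow> real \<Rightarrow> bool" where
  "alpha_bound x0 sc \<alpha> f C \<longleftrightarrow> 0 \<le> C \<and>
     (\<forall>(n::nat) x y e.
        norm (\<Sum>i<n. blinfun_apply (f (x i) - f (y i)) (e i))
          \<le> C * \<alpha> (\<Sum>i<n. delta_tensor x0 sc (x i) (y i) (e i)))"

definition Lip_alpha_ops ::
  "'x::metric_space \<Rightarrow> ('k::real_or_complex \<Rightarrow> 'e::banach \<Rightarrow> 'e) \<Rightarrow> (('x, 'e, 'k) functional \<Rightarrow> real)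
     \<Rightarrow> ('x \<Rightarrow> 'e \<Rightarrow>\<^sub>L 'k) set" where
  "Lip_alpha_ops x0 sc \<alpha> =
     {f. range f \<subseteq> dual sc \<and> f x0 = 0 \<and> (\<exists>C. alpha_bound x0 sc \<alpha> f C)}"

definition Lip_alpha ::
  "'x::metric_space \<Rightarrow> ('k::real_or_complex \<Rightarrow> 'e::banach \<Rightarrow> 'e) \<Rightarrow> (('x, 'e, 'k) functional \<Rightarrow> real)
     \<Rightarrow> ('x \<Rightarrow> 'e \<Rightarrow>\<^sub>L 'k) \<Rightarrow> real" where
  "Lip_alpha x0 sc \<alpha> f = Inf {C. alpha_bound x0 sc \<alpha> f C}"

definition lip_prod :: "('x \<Rightarrow> 'k::real_or_complex) \<Rightarrow> ('e::banach \<Rightarrow>\<^sub>L 'k) \<Rightarrow> 'x \<Rightarrow> 'e \<Rightarrow>\<^sub>L 'k" where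
  "lip_prod g \<phi> = (\<lambda>x. dual_scale (g x) \<phi>)"

definition Lip0F ::
  "'x::metric_space \<Rightarrow> ('k::real_or_complex \<Rightarrow> 'e::banach \<Rightarrow> 'e) \<Rightarrow> ('x \<Rightarrow> 'e \<Rightarrow>\<^sub>L 'k) set" where
  "Lip0F x0 sc = {f \<in> Lip0 x0 (dual sc).
     \<exists>B. finite B \<and> module.span dual_scale (range f) = module.span dual_scale B}"

end

theory Submission
  imports Defs
begin

text \<open>
  Testing the inequality that defines an \<open>\<alpha>\<close>-Lipschitz operator on the map \<open>g \<cdot> \<phi>\<close> gives back the
  inequality that defines dualizability, with the constant \<open>Lip g * norm \<phi>\<close>; so dualizability says
  exactly that this constant is admissible for \<open>g \<cdot> \<phi>\<close>. For the reverse inequality it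
  is enough to test on elementary tensors: the cross-norm property turns the inequality for
  the tensor of \<open>\<delta>\<^bsub>(x,y)\<^esub>\<close> and \<open>e\<close> into a bound for \<open>(g x - g y) * \<phi> e\<close> by \<open>C * dist x y * norm e\<close>, and
  taking the supremum over \<open>e\<close> and then over \<open>x\<close> and \<open>y\<close> gives \<open>Lip g * norm \<phi> \<le> C\<close>.

  A finite-rank \<open>f\<close> is a finite sum of maps \<open>g\<^sub>j \<cdot> \<phi>\<^sub>j\<close>, and the \<open>\<alpha>\<close>-Lipschitz operators are closed
  under sums. The one delicate point is that the coordinates \<open>g\<^sub>j\<close> of \<open>f\<close> have to be Lipschitz.
  Instead of using the continuity of coordinates on a finite-dimensional space, the expansion is
  chosen so that the coordinates are evaluations: a finite-dimensional space \<open>V\<close> of functionals on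
  \<open>E\<close> has a basis \<open>\<phi>\<^sub>j\<close> that is dual to some vectors \<open>e\<^sub>j\<close> of \<open>E\<close>, hence every \<open>\<psi>\<close> in \<open>V\<close> is the sum of
  the \<open>\<psi> e\<^sub>j * \<phi>\<^sub>j\<close> (lemma \<open>evaluation_expansion\<close>). The coordinates of \<open>f\<close> are then
  \<open>x \<mapsto> f x e\<^sub>j\<close>, which are Lipschitz because \<open>f\<close> is.
\<close>

section \<open>Functionals and Lipschitz constants\<close>

interpretation dual_vs: vector_space dual_scale
  by (rule vector_space_dual_scale)

lemma subspace_dual: "dual_vs.subspace (dual sc)"
  unfolding dual_vs.subspace_def dual_def
  by (auto simp: blinfun.add_left algebra_simps)

lemma norm_dual_scale: "norm (dual_scale c \<phi>) = norm c * norm \<phi>"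
proof -
  have le: "norm (dual_scale c \<phi>) \<le> norm c * norm \<phi>"
    for c and \<phi> :: "'e::banach \<Rightarrow>\<^sub>L 'k::real_or_complex"
  proof (rule norm_blinfun_bound)
    fix v
    show "norm (blinfun_apply (dual_scale c \<phi>) v) \<le> norm c * norm \<phi> * norm v"
      using mult_left_mono[OF norm_blinfun[of \<phi> v], of "norm c"] by (simp add: norm_mult mult_ac)
  qed simp
  show ?thesis
  proof (cases "c = 0")
    case False
    then have "norm \<phi> \<le> norm (inverse c) * norm (dual_scale c \<phi>)"
      using le[of "inverse c" "dual_scale c \<phi>"] by simp
    then show ?thesis
      using False le[of c \<phi>] by (simp add: norm_inverse norm_divide field_simps)
  qed simp
qed

lemma Lip_nonneg:
  assumes "g \<in> Lip0 x0 F"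
  shows "0 \<le> Lip g"
  using assms unfolding Lip0_def Lip_def
  by (auto intro!: cInf_greatest dest: lipschitz_on_nonneg)

lemma Lip_le:
  assumes "C-lipschitz_on UNIV g"
  shows "Lip g \<le> C"
  unfolding Lip_def
  by (rule cInf_lower) (auto simp: assms bdd_below_def intro: lipschitz_on_nonneg)

lemma evaluation_in_lip_dual:
  assumes "f \<in> Lip0 x0 F"
  shows "(\<lambda>x. blinfun_apply (f x) e) \<in> lip_dual x0"
proof -
  obtain C where C: "C-lipschitz_on UNIV f" and f0: "f x0 = 0"
    using assms by (auto simp: Lip0_def)
  have "(C * norm e)-lipschitz_on UNIV (\<lambda>x. blinfun_apply (f x) e)"
  proof (rule lipschitz_onI)
    show "0 \<le> C * norm e"
      using lipschitz_on_nonneg[OF C] by simp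
    fix x y
    have "dist (f x e) (f y e) \<le> norm (f x - f y) * norm e"
      by (metis blinfun.diff_left dist_norm norm_blinfun)
    also have "\<dots> \<le> C * dist x y * norm e"
      using lipschitz_onD[OF C, of x y] by (intro mult_right_mono) (auto simp: dist_norm)
    finally show "dist (f x e) (f y e) \<le> C * norm e * dist x y"
      by (simp add: mult_ac)
  qed
  then show ?thesis
    using f0 by (auto simp: Lip0_def)
qed

lemma alpha_boundD:
  assumes "alpha_bound x0 sc \<alpha> f C"
  shows "norm (\<Sum>i<n::nat. blinfun_apply (f (x i) - f (y i)) (e i))
    \<le> C * \<alpha> (\<Sum>i<n. delta_tensor x0 sc (x i) (y i) (e i))"
  using assms unfolding alpha_bound_def by blast

section \<open>Products of scalar Lipschitz functions and functionals\<close>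

text \<open>Dualizability is this bound, read as a statement about the operator \<open>g \<cdot> \<phi>\<close>.\<close>

lemma alpha_bound_lip_prod:
  assumes "dualizable x0 sc \<alpha>" "g \<in> lip_dual x0" "\<phi> \<in> dual sc"
  shows "alpha_bound x0 sc \<alpha> (lip_prod g \<phi>) (Lip g * norm \<phi>)"
  using assms Lip_nonneg[OF assms(2)]
  unfolding alpha_bound_def dualizable_def lip_prod_def
  by (simp add: blinfun.diff_left left_diff_distrib)

text \<open>Elementary tensors alone force every admissible constant to be at least
  \<open>Lip g * norm \<phi>\<close>, since there the cross-norm is known.\<close>

lemma alpha_bound_lip_prod_ge:
  assumes "lipschitz_cross_norm x0 sc \<alpha>" "alpha_bound x0 sc \<alpha> (lip_prod g \<phi>) C"
  shows "Lip g * norm \<phi> \<le> C"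
proof (cases "\<phi> = 0")
  case True
  then show ?thesis
    using assms(2) by (simp add: alpha_bound_def)
next
  case False
  have C: "0 \<le> C"
    using assms(2) by (simp add: alpha_bound_def)
  have elementary: "norm (g x - g y) * norm (blinfun_apply \<phi> e) \<le> C * (dist x y * norm e)" for x y e
  proof -
    have "norm (\<Sum>i<1::nat. blinfun_apply (lip_prod g \<phi> x - lip_prod g \<phi> y) e)
        \<le> C * \<alpha> (\<Sum>i<1::nat. delta_tensor x0 sc x y e)"
      by (rule alpha_boundD[OF assms(2)])
    then show ?thesis
      using assms(1)
      by (simp add: lipschitz_cross_norm_def lip_prod_def blinfun.diff_left
          left_diff_distrib[symmetric] norm_mult)
  qed
  have "norm (g x - g y) * norm \<phi> \<le> C * dist x y" for x y
  proof -
    have "norm (dual_scale (g x - g y) \<phi>) \<le> C * dist x y"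
      using elementary C
      by (intro norm_blinfun_bound) (auto simp: norm_mult mult_ac simp del: dual_vs.scale_left_diff_distrib)
    then show ?thesis
      by (simp only: norm_dual_scale)
  qed
  then have "(C / norm \<phi>)-lipschitz_on UNIV g"
    using False C by (intro lipschitz_onI) (auto simp: dist_norm field_simps)
  then have "Lip g \<le> C / norm \<phi>"
    by (rule Lip_le)
  then show ?thesis
    using False by (simp add: field_simps)
qed

lemma Lip_alpha_lip_prod:
  assumes "lipschitz_cross_norm x0 sc \<alpha>" "dualizable x0 sc \<alpha>" "g \<in> lip_dual x0" "\<phi> \<in> dual sc"
  shows "Lip_alpha x0 sc \<alpha> (lip_prod g \<phi>) = Lip g * norm \<phi>"
  unfolding Lip_alpha_def
  by (rule cInf_eq_minimum)
    (auto intro: alpha_bound_lip_prod alpha_bound_lip_prod_ge assms)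

lemma lip_prod_in_Lip_alpha_ops:
  assumes "dualizable x0 sc \<alpha>" "g \<in> lip_dual x0" "\<phi> \<in> dual sc"
  shows "lip_prod g \<phi> \<in> Lip_alpha_ops x0 sc \<alpha>"
proof -
  have "range (lip_prod g \<phi>) \<subseteq> dual sc"
    using assms(3) by (auto simp: lip_prod_def intro: dual_vs.subspace_scale[OF subspace_dual])
  moreover have "lip_prod g \<phi> x0 = 0"
    using assms(2) by (simp add: lip_prod_def Lip0_def)
  ultimately show ?thesis
    using alpha_bound_lip_prod[OF assms] by (auto simp: Lip_alpha_ops_def)
qed

section \<open>Finite-rank operators\<close>

lemma alpha_bound_add:
  assumes "alpha_bound x0 sc \<alpha> f C" "alpha_bound x0 sc \<alpha> h D"
  shows "alpha_bound x0 sc \<alpha> (\<lambda>x. f x + h x) (C + D)"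
proof -
  have "norm (\<Sum>i<n. blinfun_apply ((f (x i) + h (x i)) - (f (y i) + h (y i))) (e i))
      \<le> (C + D) * \<alpha> (\<Sum>i<n. delta_tensor x0 sc (x i) (y i) (e i))" for n :: nat and x y e
  proof -
    let ?u = "\<Sum>i<n. delta_tensor x0 sc (x i) (y i) (e i)"
    have "(\<Sum>i<n. blinfun_apply ((f (x i) + h (x i)) - (f (y i) + h (y i))) (e i))
        = (\<Sum>i<n. blinfun_apply (f (x i) - f (y i)) (e i))
          + (\<Sum>i<n. blinfun_apply (h (x i) - h (y i)) (e i))"
      by (simp add: sum.distrib[symmetric] blinfun.diff_left blinfun.add_left algebra_simps)
    also have "norm \<dots> \<le> C * \<alpha> ?u + D * \<alpha> ?u"
      by (intro norm_triangle_mono alpha_boundD assms)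
    finally show ?thesis
      by (simp add: algebra_simps)
  qed
  then show ?thesis
    using assms by (auto simp: alpha_bound_def)
qed

lemma Lip_alpha_ops_zero: "(\<lambda>x. 0) \<in> Lip_alpha_ops x0 sc \<alpha>"
  unfolding Lip_alpha_ops_def alpha_bound_def
  by (auto intro!: exI[of _ 0] dual_vs.subspace_0[OF subspace_dual])

lemma Lip_alpha_ops_add:
  assumes "f \<in> Lip_alpha_ops x0 sc \<alpha>" "h \<in> Lip_alpha_ops x0 sc \<alpha>"
  shows "(\<lambda>x. f x + h x) \<in> Lip_alpha_ops x0 sc \<alpha>"
proof -
  obtain C D where "alpha_bound x0 sc \<alpha> f C" "alpha_bound x0 sc \<alpha> h D"
    using assms by (auto simp: Lip_alpha_ops_def)
  then have "alpha_bound x0 sc \<alpha> (\<lambda>x. f x + h x) (C + D)"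
    by (rule alpha_bound_add)
  moreover have "range (\<lambda>x. f x + h x) \<subseteq> dual sc"
    using assms by (auto simp: Lip_alpha_ops_def intro!: dual_vs.subspace_add[OF subspace_dual])
  ultimately show ?thesis
    using assms by (auto simp: Lip_alpha_ops_def)
qed

lemma Lip_alpha_ops_sum_list:
  assumes "\<And>p. p \<in> set ps \<Longrightarrow> h p \<in> Lip_alpha_ops x0 sc \<alpha>"
  shows "(\<lambda>x. \<Sum>p\<leftarrow>ps. h p x) \<in> Lip_alpha_ops x0 sc \<alpha>"
  using assms by (induction ps) (auto intro: Lip_alpha_ops_zero Lip_alpha_ops_add)

lemma blinfun_apply_dual_sum_list:
  assumes "banach_over sc" "\<psi> \<in> dual sc"
  shows "blinfun_apply \<psi> (\<Sum>p\<leftarrow>ps. sc (c p) (v p)) = (\<Sum>p\<leftarrow>ps. c p * blinfun_apply \<psi> (v p))"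
  using assms(2) by (induction ps) (auto simp: blinfun.add_right dual_def)

lemma blinfun_apply_sum_list_left:
  "blinfun_apply (\<Sum>p\<leftarrow>ps. F p) v = (\<Sum>p\<leftarrow>ps. blinfun_apply (F p) v)"
  by (induction ps) (auto simp: blinfun.add_left)

text \<open>The pairs \<open>(\<phi>\<^sub>j, e\<^sub>j)\<close> are built one generator at a time. Let \<open>P \<psi>\<close> be the sum for the pairs
  found so far; it fixes the span of the previous generators. If the residue \<open>r = b - P b\<close> of a new
  generator \<open>b\<close> vanishes, then the old pairs suffice. Otherwise \<open>r e \<noteq> 0\<close> for some \<open>e\<close>, and the
  residue of any \<open>\<psi>\<close> in the new span is a multiple of \<open>r\<close>, with the factor \<open>(\<psi> - P \<psi>) e / r e\<close>.
  Here \<open>(\<psi> - P \<psi>) e\<close> is the value \<open>\<psi> e'\<close>, where \<open>e'\<close> is \<open>e\<close> minus the sum of the \<open>\<phi>\<^sub>j e * e\<^sub>j\<close>. So the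
  pair of \<open>r / r e\<close> and \<open>e'\<close> is added and the old pairs stay as they are.\<close>

lemma evaluation_expansion:
  assumes "banach_over sc" "finite B" "B \<subseteq> dual sc"
  shows "\<exists>ps. (\<forall>p\<in>set ps. fst p \<in> dual sc) \<and>
    (\<forall>\<psi>\<in>dual_vs.span B. \<psi> = (\<Sum>p\<leftarrow>ps. dual_scale (blinfun_apply \<psi> (snd p)) (fst p)))"
  using assms(2,3)
proof (induction B rule: finite_induct)
  case empty
  show ?case by (intro exI[of _ "[]"]) simp
next
  case (insert b B)
  then obtain ps where ps: "\<And>p. p \<in> set ps \<Longrightarrow> fst p \<in> dual sc"
    and expand: "\<And>\<psi>. \<psi> \<in> dual_vs.span B \<Longrightarrow>
      \<psi> = (\<Sum>p\<leftarrow>ps. dual_scale (blinfun_apply \<psi> (snd p)) (fst p))"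
    by auto
  define P where "P \<psi> = (\<Sum>p\<leftarrow>ps. dual_scale (blinfun_apply \<psi> (snd p)) (fst p))" for \<psi>
  have P_add: "P (\<psi> + \<eta>) = P \<psi> + P \<eta>" for \<psi> \<eta>
    unfolding P_def
    by (simp add: sum_list_addf blinfun.add_left dual_vs.scale_left_distrib)
  have P_scale: "P (dual_scale c \<psi>) = dual_scale c (P \<psi>)" for c \<psi>
    unfolding P_def
    by (induction ps) (simp_all add: dual_vs.scale_right_distrib)
  have P_dual: "P \<psi> \<in> dual sc" for \<psi>
    unfolding P_def using ps
    by (induction ps)
      (auto intro!: dual_vs.subspace_0 dual_vs.subspace_add dual_vs.subspace_scale subspace_dual)
  define r where "r = b - P b"
  have r_dual: "r \<in> dual sc"
    using insert.prems P_dual by (auto simp: r_def intro!: dual_vs.subspace_diff subspace_dual)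
  have residue: "\<exists>c. \<psi> - P \<psi> = dual_scale c r" if \<psi>: "\<psi> \<in> dual_vs.span (insert b B)" for \<psi>
  proof -
    obtain c where "\<psi> - dual_scale c b \<in> dual_vs.span B"
      using \<psi> by (auto simp: dual_vs.span_insert)
    then have fixed: "P (\<psi> - dual_scale c b) = \<psi> - dual_scale c b"
      using expand unfolding P_def by metis
    have "P \<psi> = P (\<psi> - dual_scale c b) + dual_scale c (P b)"
      using P_add[of "\<psi> - dual_scale c b" "dual_scale c b"] by (simp add: P_scale)
    with fixed have "\<psi> - P \<psi> = dual_scale c r"
      by (simp add: r_def dual_vs.scale_right_diff_distrib)
    then show ?thesis ..
  qed
  show ?case
  proof (cases "r = 0")
    case True
    have "\<psi> = P \<psi>" if "\<psi> \<in> dual_vs.span (insert b B)" for \<psi>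
      using residue[OF that] True by auto
    then show ?thesis
      using ps unfolding P_def by (intro exI[of _ ps]) blast
  next
    case False
    then obtain e where e: "blinfun_apply r e \<noteq> 0"
      by (metis blinfun_eqI zero_blinfun.rep_eq)
    define e' where "e' = e - (\<Sum>p\<leftarrow>ps. sc (blinfun_apply (fst p) e) (snd p))"
    define \<phi> where "\<phi> = dual_scale (inverse (blinfun_apply r e)) r"
    have \<phi>: "\<phi> \<in> dual sc"
      using r_dual by (auto simp: \<phi>_def intro: dual_vs.subspace_scale subspace_dual)
    have "\<psi> = (\<Sum>p\<leftarrow>(\<phi>, e') # ps. dual_scale (blinfun_apply \<psi> (snd p)) (fst p))"
      if \<psi>: "\<psi> \<in> dual_vs.span (insert b B)" for \<psi>
    proof -
      have "\<psi> \<in> dual sc"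
        using \<psi> dual_vs.span_minimal[OF insert.prems subspace_dual] by auto
      then have e': "blinfun_apply \<psi> e' = blinfun_apply (\<psi> - P \<psi>) e"
        by (simp add: e'_def P_def blinfun.diff_right blinfun.diff_left
            blinfun_apply_dual_sum_list[OF assms(1)] blinfun_apply_sum_list_left mult.commute)
      obtain c where c: "\<psi> - P \<psi> = dual_scale c r"
        using residue[OF \<psi>] ..
      have "dual_scale (blinfun_apply \<psi> e') \<phi> = \<psi> - P \<psi>"
        unfolding e' c \<phi>_def using e by simp
      then show ?thesis
        by (simp add: P_def algebra_simps)
    qed
    then show ?thesis
      using ps \<phi> by (intro exI[of _ "(\<phi>, e') # ps"]) auto
  qed
qed

lemma Lip0F_subset_Lip_alpha_ops:
  assumes "banach_over sc" "dualizable x0 sc \<alpha>"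
  shows "Lip0F x0 sc \<subseteq> Lip_alpha_ops x0 sc \<alpha>"
proof
  fix f
  assume "f \<in> Lip0F x0 sc"
  then obtain B where f: "f \<in> Lip0 x0 (dual sc)" and B: "finite B"
    and span: "dual_vs.span (range f) = dual_vs.span B"
    by (auto simp: Lip0F_def)
  have "range f \<subseteq> dual sc"
    using f by (simp add: Lip0_def)
  then have "B \<subseteq> dual sc"
    using dual_vs.span_minimal[OF _ subspace_dual] dual_vs.span_superset[of B] span by blast
  then obtain ps where ps: "\<And>p. p \<in> set ps \<Longrightarrow> fst p \<in> dual sc"
    and expand: "\<And>\<psi>. \<psi> \<in> dual_vs.span B \<Longrightarrow>
      \<psi> = (\<Sum>p\<leftarrow>ps. dual_scale (blinfun_apply \<psi> (snd p)) (fst p))"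
    using evaluation_expansion[OF assms(1) B] by metis
  have "f x \<in> dual_vs.span B" for x
    unfolding span[symmetric] by (rule dual_vs.span_base) simp
  then have "f = (\<lambda>x. \<Sum>p\<leftarrow>ps. lip_prod (\<lambda>x. blinfun_apply (f x) (snd p)) (fst p) x)"
    unfolding lip_prod_def using expand by blast
  also have "\<dots> \<in> Lip_alpha_ops x0 sc \<alpha>"
    by (intro Lip_alpha_ops_sum_list lip_prod_in_Lip_alpha_ops
        assms(2) evaluation_in_lip_dual[OF f] ps)
  finally show "f \<in> Lip_alpha_ops x0 sc \<alpha>" .
qed

theorem theorem4p1:
  fixes x0 :: "'x::metric_space"
    and sc :: "'k::real_or_complex \<Rightarrow> 'e::banach \<Rightarrow> 'e"
    and \<alpha> :: "('x, 'e, 'k) functional \<Rightarrow> real"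
  assumes "banach_over sc"
    and "lipschitz_cross_norm x0 sc \<alpha>"
    and "dualizable x0 sc \<alpha>"
  shows "(\<forall>g \<in> lip_dual x0. \<forall>\<phi> \<in> dual sc.
            lip_prod g \<phi> \<in> Lip_alpha_ops x0 sc \<alpha>
            \<and> Lip_alpha x0 sc \<alpha> (lip_prod g \<phi>) = Lip g * norm \<phi>)
         \<and> Lip0F x0 sc \<subseteq> Lip_alpha_ops x0 sc \<alpha>"
  using lip_prod_in_Lip_alpha_ops[OF assms(3)] Lip_alpha_lip_prod[OF assms(2,3)]
    Lip0F_subset_Lip_alpha_ops[OF assms(1,3)]
  by blast

end
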